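(* Let $\mathcal{H}\subseteq\mathcal{K}$ be complex Hilbert spaces, let $T\in\mathcal{B}(\mathcal{H})$ be a contraction and let $V\in\mathcal{B}(\mathcal{K})$ be an isometric lifting of $T$. Let $X\in\mathcal{B}(\mathcal{H})$. Let $Q\in\mathcal{B}(\mathcal{H})$ and $\overline{Q}\in\mathcal{B}(\mathcal{K})$ be contractions such that $\mathcal{H}$ reduces $\overline{Q}$ and $\overline{Q}|_{\mathcal{H}}=Q$. (i) If $XT=QTX$, then there exists a lifting $Y\in\mathcal{B}(\mathcal{K})$ of $X$ such that $YV=\overline{Q}VY$. (ii) If $XT=TQX$, then there exists a lifting $Y\in\mathcal{B}(\mathcal{K})$ of $X$ such that $YV=V\overline{Q}Y$. (iii) If moreover $Q$ and $\overline{Q}$ are unitary and $XT=TXQ$, then there exists a lifting $Y\in\mathcal{B}(\mathcal{K})$ of $X$ such that $YV=VY\overline{Q}$. In all cases $T^nX^m=P_{\mathcal{H}}V^nY^m|_{\mathcal{H}}$ and $X^nT^m=P_{\mathcal{H}}Y^nV^m|_{\mathcal{H}}$ for all integers $n,m\geq 0$, and $Y$ can be chosen such that $\|Y\|=\|X\|$.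
   Context: For Hilbert spaces $\mathcal{H}\subseteq\mathcal{K}$, $S\in\mathcal{B}(\mathcal{K})$ is a lifting of $T\in\mathcal{B}(\mathcal{H})$ if $S(\mathcal{H}^\perp)\subseteq\mathcal{H}^\perp$ and $T=P_{\mathcal{H}}S|_{\mathcal{H}}$ (equivalently $S^*|_{\mathcal{H}}=T^*$); an isometric lifting of $T$ is a lifting that is an isometry. $P_{\mathcal{H}}$ is the orthogonal projection onto $\mathcal{H}$. *)

theory Defs
  imports "HOL-Analysis.Analysis"
begin

text \<open>HOL-Analysis only provides real inner product spaces. A complex Hilbert
space is modelled as a real Hilbert space (class real_inner + complete_space)
equipped with a compatible complex scalar multiplication that is isometric in the
sense norm (scaleC a x) = cmod a * norm x. The complex inner product is then
determined by the real one; we define it explicitly below.\<close>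

class complex_vector = real_vector +
  fixes scaleC :: "complex \<Rightarrow> 'a \<Rightarrow> 'a"
  assumes scaleC_add_right: "scaleC a (x + y) = scaleC a x + scaleC a y"
    and scaleC_add_left: "scaleC (a + b) x = scaleC a x + scaleC b x"
    and scaleC_scaleC: "scaleC a (scaleC b x) = scaleC (a * b) x"
    and scaleC_one: "scaleC 1 x = x"
    and scaleC_of_real: "scaleC (complex_of_real r) x = scaleR r x"

class complex_hilbert = complex_vector + real_inner + complete_space +
  assumes norm_scaleC: "norm (scaleC a x) = cmod a * norm x"

instantiation complex :: complex_hilbert
begin
definition scaleC_complex :: "complex \<Rightarrow> complex \<Rightarrow> complex" where
  "scaleC_complex a x = a * x"
instance
  by standard (auto simp: scaleC_complex_def algebra_simps norm_mult scaleR_conv_of_real)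
end

text \<open>Complex inner product (conjugate-linear in the first argument).\<close>
definition cinner :: "'a::complex_hilbert \<Rightarrow> 'a \<Rightarrow> complex" where
  "cinner x y = Complex (inner x y) (- inner x (scaleC \<i> y))"

definition csubspace :: "'a::complex_hilbert set \<Rightarrow> bool" where
  "csubspace S \<longleftrightarrow> 0 \<in> S \<and> (\<forall>x\<in>S. \<forall>y\<in>S. x + y \<in> S) \<and> (\<forall>c. \<forall>x\<in>S. scaleC c x \<in> S)"

definition closed_csubspace :: "'a::complex_hilbert set \<Rightarrow> bool" where
  "closed_csubspace S \<longleftrightarrow> csubspace S \<and> closed S"

definition orthocompl :: "'a::complex_hilbert set \<Rightarrow> 'a set" where
  "orthocompl S = {y. \<forall>x\<in>S. cinner x y = 0}"

definition proj :: "'a::complex_hilbert set \<Rightarrow> 'a \<Rightarrow> 'a" where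
  "proj S x = (THE h. h \<in> S \<and> x - h \<in> orthocompl S)"

text \<open>An element of B(S) for a closed subspace S of K is represented by a function
'a => 'a that maps S into S and is complex-linear and bounded on S; its values
outside S are irrelevant. B(K) corresponds to S = UNIV.\<close>

definition bounded_op_on :: "'a::complex_hilbert set \<Rightarrow> ('a \<Rightarrow> 'a) \<Rightarrow> bool" where
  "bounded_op_on S f \<longleftrightarrow> f ` S \<subseteq> S
     \<and> (\<forall>x\<in>S. \<forall>y\<in>S. f (x + y) = f x + f y)
     \<and> (\<forall>c. \<forall>x\<in>S. f (scaleC c x) = scaleC c (f x))
     \<and> (\<exists>B. \<forall>x\<in>S. norm (f x) \<le> B * norm x)"

definition opnorm_on :: "'a::complex_hilbert set \<Rightarrow> ('a \<Rightarrow> 'a) \<Rightarrow> real" where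
  "opnorm_on S f = (SUP x\<in>S. norm (f x) / norm x)"

definition contraction_on :: "'a::complex_hilbert set \<Rightarrow> ('a \<Rightarrow> 'a) \<Rightarrow> bool" where
  "contraction_on S f \<longleftrightarrow> bounded_op_on S f \<and> (\<forall>x\<in>S. norm (f x) \<le> norm x)"

definition isometry_on :: "'a::complex_hilbert set \<Rightarrow> ('a \<Rightarrow> 'a) \<Rightarrow> bool" where
  "isometry_on S f \<longleftrightarrow> bounded_op_on S f \<and> (\<forall>x\<in>S. norm (f x) = norm x)"

definition unitary_on :: "'a::complex_hilbert set \<Rightarrow> ('a \<Rightarrow> 'a) \<Rightarrow> bool" where
  "unitary_on S f \<longleftrightarrow> isometry_on S f \<and> f ` S = S"

definition lifting :: "'a::complex_hilbert set \<Rightarrow> ('a \<Rightarrow> 'a) \<Rightarrow> ('a \<Rightarrow> 'a) \<Rightarrow> bool" where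
  "lifting H T S \<longleftrightarrow> bounded_op_on UNIV S \<and> S ` orthocompl H \<subseteq> orthocompl H
     \<and> (\<forall>h\<in>H. T h = proj H (S h))"

definition isometric_lifting :: "'a::complex_hilbert set \<Rightarrow> ('a \<Rightarrow> 'a) \<Rightarrow> ('a \<Rightarrow> 'a) \<Rightarrow> bool" where
  "isometric_lifting H T S \<longleftrightarrow> lifting H T S \<and> isometry_on UNIV S"

definition reduces :: "'a::complex_hilbert set \<Rightarrow> ('a \<Rightarrow> 'a) \<Rightarrow> bool" where
  "reduces H S \<longleftrightarrow> S ` H \<subseteq> H \<and> S ` orthocompl H \<subseteq> orthocompl H"

end

theory Submission
  imports Defs
begin

text \<open>
  All three parts are instances of one intertwining lifting theorem: if \<open>V\<close> is an isometric lifting of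
  \<open>T\<close>, \<open>W\<close> a contractive lifting of \<open>S\<close> and \<open>X T = S X\<close>, then \<open>X\<close> has a norm-preserving lifting \<open>Y\<close>
  with \<open>Y V = W Y\<close>. For (i) take \<open>W = Qb V\<close>, for (ii) \<open>W = V Qb\<close>, and for (iii) replace \<open>V\<close> by
  \<open>V Qb\<^sup>-\<^sup>1\<close> and take \<open>W = V\<close>.

  To construct \<open>Y\<close> for a contraction \<open>X\<close>, write \<open>P\<close> for the projection onto \<open>H\<close> and \<open>Y = X P + Z\<close> with
  \<open>Z\<close> mapping into the orthogonal complement of \<open>H\<close>. Then \<open>Y\<close> is a contraction iff \<open>Z\<close> is a contraction
  for the seminorm \<open>p\<close> with \<open>p(k)\<^sup>2 = |k|\<^sup>2 - |X P k|\<^sup>2\<close>, and \<open>Y V = W Y\<close> prescribes \<open>Z\<close> on the range of \<open>V\<close>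
  in terms of \<open>Z\<close>. Extending by the \<open>p\<close>-orthogonal projection onto that range turns the equation into a
  fixed point problem for an affine map that preserves the \<open>p\<close>-contractions. Damping its linear part by a
  factor below 1 makes the iterates converge, which gives approximate solutions, and a
  weak operator cluster point of these is an exact one.
\<close>

section \<open>Hilbert spaces: projections, Riesz representation, weak compactness\<close>

text \<open>First variation: otherwise moving \<open>p\<close> along \<open>s\<close> would bring it
  closer to \<open>x\<close>.\<close>

lemma min_dist_orthogonal:
  fixes S :: "'a::real_inner set"
  assumes S: "subspace S" and p: "p \<in> S" and min: "\<And>s. s \<in> S \<Longrightarrow> norm (x - p) \<le> norm (x - s)"
    and s: "s \<in> S"
  shows "inner s (x - p) = 0"
proof (cases "s = 0")
  case False
  \<comment> \<open>The minimiser of \<open>norm (x - p - t *\<^sub>R s)\<close> over real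
    \<open>t\<close>; this shift lowers the squared distance by
    \<open>(inner s (x - p))\<^sup>2 / inner s s\<close>.\<close>
  define t where "t = inner s (x - p) / inner s s"
  have ss: "inner s s > 0" using False by simp
  have "p + t *\<^sub>R s \<in> S" using S p s by (simp add: subspace_add subspace_scale)
  from min[OF this] have "norm (x - p) \<le> norm ((x - p) - t *\<^sub>R s)"
    by (simp add: algebra_simps)
  then have "inner (x - p) (x - p) \<le> inner ((x - p) - t *\<^sub>R s) ((x - p) - t *\<^sub>R s)"
    by (simp add: norm_le)
  also have "\<dots> = inner (x - p) (x - p) - 2 * t * inner s (x - p) + t * t * inner s s"
    by (simp add: inner_diff_left inner_diff_right inner_commute algebra_simps)
  also have "t * t * inner s s = t * inner s (x - p)"
    using ss by (simp add: t_def)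
  finally have "t * inner s (x - p) \<le> 0" by simp
  moreover have "t * inner s (x - p) = (inner s (x - p))\<^sup>2 / inner s s"
    by (simp add: t_def power2_eq_square)
  ultimately have "(inner s (x - p))\<^sup>2 \<le> 0" using ss by (simp add: divide_le_0_iff)
  then show ?thesis by simp
qed simp

theorem orthogonal_projection_exists:
  fixes S :: "'a::{real_inner,complete_space} set"
  assumes S: "subspace S" and cl: "closed S"
  obtains p where "p \<in> S" "\<And>s. s \<in> S \<Longrightarrow> inner s (x - p) = 0"
proof -
  have ne: "S \<noteq> {}" using S subspace_0 by blast
  define d where "d = infdist x S"
  have dle: "d \<le> norm (x - s)" if "s \<in> S" for s
    using infdist_le[OF that, of x] by (simp add: d_def dist_norm)
  have d0: "d \<ge> 0" by (simp add: d_def infdist_nonneg)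
  \<comment> \<open>The slack is put on the squared distance, because that is the quantity in the
    parallelogram identity of \<open>par\<close>.\<close>
  have "\<exists>s\<in>S. norm (x - s) < sqrt (d\<^sup>2 + 1 / Suc n)" for n
  proof -
    have "d < sqrt (d\<^sup>2 + 1 / Suc n)" by (rule real_less_rsqrt) simp
    then show ?thesis
      using ne by (auto simp: d_def dist_norm infdist_notempty cINF_less_iff bdd_belowI2[of _ 0])
  qed
  then obtain s where sS: "\<And>n. s n \<in> S" and sn: "\<And>n. norm (x - s n) < sqrt (d\<^sup>2 + 1 / Suc n)"
    by metis
  have sn2: "(norm (x - s n))\<^sup>2 < d\<^sup>2 + 1 / Suc n" for n
    using power_strict_mono[OF sn[of n], of 2] by (simp add: add_nonneg_nonneg)
  \<comment> \<open>Parallelogram law: the midpoint of \<open>s m\<close> and \<open>s n\<close>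
    lies in \<open>S\<close>, hence at distance at least \<open>d\<close> from \<open>x\<close>, so
    a minimising sequence is Cauchy.\<close>
  have par: "(norm (s m - s n))\<^sup>2 \<le> 2 / Suc m + 2 / Suc n" for m n
  proof -
    have "(1/2) *\<^sub>R (s m + s n) \<in> S" using S sS by (simp add: subspace_add subspace_scale)
    from dle[OF this] have "d\<^sup>2 \<le> (norm (x - (1/2) *\<^sub>R (s m + s n)))\<^sup>2"
      using d0 by (simp add: power_mono)
    moreover have "(norm (s m - s n))\<^sup>2 = 2 * (norm (x - s m))\<^sup>2 + 2 * (norm (x - s n))\<^sup>2
        - 4 * (norm (x - (1/2) *\<^sub>R (s m + s n)))\<^sup>2"
      by (simp add: power2_norm_eq_inner inner_diff_left inner_diff_right inner_add_left
          inner_add_right inner_commute algebra_simps)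
    ultimately show ?thesis using sn2[of m] sn2[of n] by simp
  qed
  have "Cauchy s"
  proof (rule metric_CauchyI)
    fix e :: real assume e: "e > 0"
    obtain N where N: "4 / e\<^sup>2 < real N" using reals_Archimedean2 by blast
    have "dist (s m) (s n) < e" if mn: "m \<ge> N" "n \<ge> N" for m n
    proof -
      have *: "2 / real (Suc k) < e\<^sup>2 / 2" if "k \<ge> N" for k
      proof -
        have "4 / e\<^sup>2 < real (Suc k)" using N that by linarith
        then show ?thesis using e by (simp add: field_simps)
      qed
      have "(norm (s m - s n))\<^sup>2 < e\<^sup>2" using par[of m n] *[OF mn(1)] *[OF mn(2)] by simp
      then show ?thesis using e by (simp add: dist_norm power_less_imp_less_base)
    qed
    then show "\<exists>N. \<forall>m\<ge>N. \<forall>n\<ge>N. dist (s m) (s n) < e" by blast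
  qed
  then obtain p where p: "s \<longlonglongrightarrow> p" using Cauchy_convergent convergentD by blast
  have pS: "p \<in> S" using closed_sequentially[OF cl sS p] .
  have "(norm (x - p))\<^sup>2 \<le> d\<^sup>2 + 0"
  proof (rule LIMSEQ_le)
    show "(\<lambda>n. (norm (x - s n))\<^sup>2) \<longlonglongrightarrow> (norm (x - p))\<^sup>2" by (intro tendsto_intros p)
    show "(\<lambda>n. d\<^sup>2 + 1 / real (Suc n)) \<longlonglongrightarrow> d\<^sup>2 + 0"
      by (intro tendsto_intros LIMSEQ_Suc[OF lim_1_over_n])
  qed (use less_imp_le[OF sn2] in simp)
  then have "norm (x - p) \<le> d" using d0 by (simp add: power2_le_iff_abs_le)
  then have "norm (x - p) \<le> norm (x - s)" if "s \<in> S" for s using dle[OF that] by simp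
  with that[OF pS] show thesis using min_dist_orthogonal[OF S pS] by metis
qed

section \<open>Riesz representation and adjoints\<close>

theorem Riesz_representation:
  fixes f :: "'a::{real_inner,complete_space} \<Rightarrow> real"
  assumes f: "bounded_linear f"
  obtains y where "\<And>x. f x = inner x y"
proof (cases "\<forall>x. f x = 0")
  case True
  then show thesis using that[of 0] by simp
next
  case False
  then obtain x0 where x0: "f x0 \<noteq> 0" by blast
  interpret bounded_linear f by fact
  define S where "S = {x. f x = 0}"
  have "subspace S" by (simp add: S_def subspace_def add scale zero)
  moreover have "closed S" unfolding S_def
    by (intro closed_Collect_eq continuous_intros linear_continuous_on f)
  ultimately obtain p where p: "p \<in> S" and orth: "\<And>s. s \<in> S \<Longrightarrow> inner s (x0 - p) = 0"
    using orthogonal_projection_exists by metis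
  define u where "u = x0 - p"
  have fu: "f u \<noteq> 0" using p x0 by (simp add: u_def S_def diff)
  then have uu: "inner u u \<noteq> 0" using zero by auto
  have "f x = inner x ((f u / inner u u) *\<^sub>R u)" for x
  proof -
    \<comment> \<open>The kernel has codimension one: subtracting a multiple of \<open>u\<close>
      moves \<open>x\<close> into the kernel, which is orthogonal to \<open>u\<close>.\<close>
    have "x - (f x / f u) *\<^sub>R u \<in> S" using fu by (simp add: S_def diff scale)
    from orth[OF this] have "inner x u = (f x / f u) * inner u u"
      by (simp add: u_def inner_diff_left)
    then show ?thesis using fu uu by simp
  qed
  then show thesis using that by blast
qed

lemma inner_eq_all_imp_eq:
  fixes x y :: "'a::real_inner"
  assumes "\<And>l. inner l x = inner l y"
  shows "x = y"
  using assms[of "x - y"] by (metis inner_diff_right inner_eq_zero_iff right_minus_eq)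

lemma bounded_linear_if_bound:
  assumes "linear f" "\<And>x. norm (f x) \<le> c * norm x"
  shows "bounded_linear f"
  by (rule bounded_linear_intro[of _ c])
    (simp_all add: linear_add[OF assms(1)] linear_scale[OF assms(1)] assms(2) mult.commute[of _ c])

text \<open>Riesz representation of \<open>inner (f x) y\<close> as a functional of
  \<open>x\<close>. The adjoint is taken for the real inner product; the bound follows from |g y|^2
  = inner (f (g y)) y.\<close>

lemma adjoint_exists:
  fixes f :: "'a::{real_inner,complete_space} \<Rightarrow> 'b::real_inner"
  assumes f: "linear f" and c0: "c \<ge> 0" and c: "\<And>x. norm (f x) \<le> c * norm x"
  obtains g where "\<And>x y. inner (f x) y = inner x (g y)" "linear g" "\<And>y. norm (g y) \<le> c * norm y"
proof -
  have "\<exists>g. \<forall>x. inner (f x) y = inner x g" for y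
    using Riesz_representation[OF bounded_linear_compose[OF bounded_linear_inner_left
          bounded_linear_if_bound[OF f c]]] by metis
  then obtain g where g: "\<And>x y. inner (f x) y = inner x (g y)" by metis
  have "linear g"
    by (rule linearI; rule inner_eq_all_imp_eq) (simp_all add: inner_add_right flip: g)
  moreover have "norm (g y) \<le> c * norm y" for y
  proof (cases "g y = 0")
    case True
    then show ?thesis using c0 by simp
  next
    case False
    have "norm (g y) * norm (g y) = inner (f (g y)) y"
      by (simp add: g flip: power2_norm_eq_inner power2_eq_square)
    also have "\<dots> \<le> norm (f (g y)) * norm y" by (rule norm_cauchy_schwarz)
    also have "\<dots> \<le> (c * norm (g y)) * norm y" by (intro mult_right_mono c) simp
    finally show ?thesis using False by (simp add: mult.commute mult.left_commute)
  qed
  ultimately show thesis using that[OF g] by blast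
qed

text \<open>The bilinear forms of the \<open>f n\<close> live in a product of compact intervals, so Tychonoff's theorem
  yields a cluster point.\<close>

theorem contractions_weak_cluster_point:
  fixes f :: "nat \<Rightarrow> 'a::{real_inner,complete_space} \<Rightarrow> 'a"
  assumes lin: "\<And>n. linear (f n)" and contr: "\<And>n k. norm (f n k) \<le> norm k"
  obtains F :: "nat filter" and Y where "F \<noteq> bot" "F \<le> sequentially"
    "\<And>k l. ((\<lambda>n. inner l (f n k)) \<longlongrightarrow> inner l (Y k)) F"
    "linear Y" "\<And>k. norm (Y k) \<le> norm k"
proof -
  define g :: "nat \<Rightarrow> 'a \<times> 'a \<Rightarrow> real" where "g n = (\<lambda>(k, l). inner l (f n k))" for n
  define U :: "('a \<times> 'a \<Rightarrow> real) set" where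
    "U = PiE UNIV (\<lambda>(k, l). {- (norm k * norm l) .. norm k * norm l})"
  have "compactin (product_topology (\<lambda>_. euclidean) UNIV) U"
    unfolding U_def by (subst compactin_PiE) auto
  then have "compact U" by (simp add: euclidean_product_topology)
  moreover have gU: "g n \<in> U" for n
  proof -
    have "\<bar>inner l (f n k)\<bar> \<le> norm k * norm l" for k l
    proof -
      have "\<bar>inner l (f n k)\<bar> \<le> norm l * norm (f n k)" by (rule Cauchy_Schwarz_ineq2)
      also have "\<dots> \<le> norm l * norm k" by (intro mult_left_mono contr) auto
      finally show ?thesis by (simp add: mult.commute)
    qed
    then show ?thesis by (auto simp: U_def g_def abs_le_iff minus_le_iff)
  qed
  moreover have "filtermap g sequentially \<noteq> bot" by (simp add: filtermap_bot_iff)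
  moreover have "eventually (\<lambda>b. b \<in> U) (filtermap g sequentially)"
    using gU by (simp add: eventually_filtermap)
  ultimately obtain B where B: "B \<in> U" "inf (nhds B) (filtermap g sequentially) \<noteq> bot"
    unfolding compact_filter by meson
  \<comment> \<open>This filter stands in for a convergent subsequence: a product of uncountably
    many intervals need not be sequentially compact.\<close>
  define F where "F = inf sequentially (filtercomap g (nhds B))"
  have F0: "F \<noteq> bot"
  \<comment> \<open>If \<open>F\<close> were trivial, a tail of the sequence would avoid a
    neighbourhood of \<open>B\<close>, which is then no cluster point.\<close>
  proof
    assume "F = bot"
    then have "eventually (\<lambda>_. False) F" by simp
    then obtain P Q where P: "eventually P sequentially"
      and Q: "eventually Q (filtercomap g (nhds B))" and PQ: "\<And>n. P n \<Longrightarrow> Q n \<Longrightarrow> False"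
      unfolding F_def eventually_inf by blast
    from Q obtain R where R: "eventually R (nhds B)" and RQ: "\<And>n. R (g n) \<Longrightarrow> Q n"
      unfolding eventually_filtercomap by blast
    have "eventually (\<lambda>b. b \<in> g ` {n. P n}) (filtermap g sequentially)"
      unfolding eventually_filtermap using P by (rule eventually_mono) auto
    with R have "eventually (\<lambda>_. False) (inf (nhds B) (filtermap g sequentially))"
      unfolding eventually_inf using PQ RQ by fast
    with B(2) show False by (simp add: eventually_False)
  qed
  have Fs: "F \<le> sequentially" by (simp add: F_def)
  have "(g \<longlongrightarrow> B) F"
    unfolding filterlim_def F_def
    by (meson filtermap_filtercomap filtermap_mono inf_le2 order_trans)
  then have lim: "((\<lambda>n. inner l (f n k)) \<longlongrightarrow> B (k, l)) F" for k l
    using continuous_on_tendsto_compose[OF continuous_on_product_coordinates[of "(k, l)"], of g B F]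
    by (simp add: g_def)
  have bd: "\<bar>B (k, l)\<bar> \<le> norm l * norm k" for k l
    using PiE_mem[OF B(1)[unfolded U_def], of "(k, l)"] by (auto simp: mult.commute)
  note uniq = tendsto_unique[OF F0]
  \<comment> \<open>For fixed \<open>k\<close> the limit form is a bounded functional of
    \<open>l\<close>; its Riesz vector is the value \<open>Y k\<close>.\<close>
  have "\<exists>y. \<forall>l. B (k, l) = inner l y" for k
  proof -
    have "bounded_linear (\<lambda>l. B (k, l))"
    proof (rule bounded_linear_intro)
      show "B (k, l + l') = B (k, l) + B (k, l')" for l l'
        by (rule uniq[OF lim]) (simp add: inner_add_left tendsto_add lim)
      show "B (k, r *\<^sub>R l) = r *\<^sub>R B (k, l)" for r l
        by (rule uniq[OF lim]) (simp add: tendsto_mult_left lim)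
      show "norm (B (k, l)) \<le> norm l * norm k" for l using bd by simp
    qed
    then show ?thesis using Riesz_representation by metis
  qed
  then obtain Y where Y: "\<And>k l. B (k, l) = inner l (Y k)" by metis
  note lim = lim[unfolded Y]
  have "linear Y"
  proof (rule linearI)
    show "Y (a + b) = Y a + Y b" for a b
      by (rule inner_eq_all_imp_eq, rule uniq[OF lim])
        (simp add: linear_add[OF lin] inner_add_right tendsto_add lim)
    show "Y (r *\<^sub>R a) = r *\<^sub>R Y a" for r a
      by (rule inner_eq_all_imp_eq, rule uniq[OF lim])
        (simp add: linear_scale[OF lin] tendsto_mult_left lim)
  qed
  moreover have "norm (Y k) \<le> norm k" for k
  proof (cases "Y k = 0")
    case False
    have "norm (Y k) * norm (Y k) \<le> norm (Y k) * norm k"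
      using bd[of k "Y k"] by (simp add: Y flip: power2_norm_eq_inner power2_eq_square)
    then show ?thesis using False by simp
  qed simp
  ultimately show thesis using that[OF F0 Fs lim] by blast
qed

section \<open>The intertwining lifting theorem\<close>

definition complex_linear :: "('a::complex_hilbert \<Rightarrow> 'b::complex_hilbert) \<Rightarrow> bool" where
  "complex_linear f \<longleftrightarrow> (\<forall>x y. f (x + y) = f x + f y) \<and> (\<forall>c x. f (scaleC c x) = scaleC c (f x))"

lemma complex_linear_scaleC: "complex_linear f \<Longrightarrow> f (scaleC c x) = scaleC c (f x)"
  by (simp add: complex_linear_def)

lemma complex_linear_imp_linear: "complex_linear f \<Longrightarrow> linear f"
  unfolding complex_linear_def by (metis linearI scaleC_of_real)

lemma complex_linearI:
  "linear f \<Longrightarrow> (\<And>c x. f (scaleC c x) = scaleC c (f x)) \<Longrightarrow> complex_linear f"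
  by (simp add: complex_linear_def linear_add)

lemma scaleC_scaleR: "scaleC c (r *\<^sub>R x) = r *\<^sub>R scaleC c (x::'a::complex_hilbert)"
  by (simp add: scaleC_scaleC mult.commute flip: scaleC_of_real)

lemma linear_scaleC: "linear (scaleC c :: 'a \<Rightarrow> 'a::complex_hilbert)"
  by (rule linearI) (simp_all add: scaleC_add_right scaleC_scaleR)

text \<open>Multiplication by \<i> preserves norms, hence by polarization the real inner product;
  apply this to \<open>x\<close> and \<open>scaleC \<i> y\<close>.\<close>

lemma inner_scaleC_ii:
  fixes x y :: "'a::complex_hilbert"
  shows "inner (scaleC \<i> x) y = - inner x (scaleC \<i> y)"
proof -
  have "inner (scaleC \<i> a) (scaleC \<i> b) = inner a b" for a b :: 'a
    unfolding dot_norm scaleC_add_right[symmetric] norm_scaleC by simp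
  from this[of x "scaleC \<i> y"] have "inner (scaleC \<i> x) (scaleC (-1) y) = inner x (scaleC \<i> y)"
    by (simp add: scaleC_scaleC)
  moreover have "scaleC (-1) y = - y" using scaleC_of_real[of "-1" y] by simp
  ultimately show ?thesis by simp
qed

lemma inner_scaleC_left:
  fixes x y :: "'a::complex_hilbert"
  shows "inner (scaleC c x) y = inner x (scaleC (cnj c) y)"
proof -
  have *: "scaleC (Complex a b) z = a *\<^sub>R z + b *\<^sub>R scaleC \<i> z" for a b and z :: 'a
  proof -
    have "Complex a b = complex_of_real a + complex_of_real b * \<i>" by (simp add: complex_eq_iff)
    then show ?thesis by (simp add: scaleC_add_left scaleC_of_real flip: scaleC_scaleC)
  qed
  show ?thesis
    by (cases c) (simp add: complex_cnj * inner_add_left inner_add_right inner_diff_right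
        inner_scaleC_ii)
qed

text \<open>\<open>P\<close> is an orthogonal projection, and \<open>X\<close> stands for the
  original operator preceded by the projection, so that all maps are total. \<open>T\<close> and
  \<open>S\<close> are eliminated: \<open>PWP\<close> says that \<open>W\<close> preserves the
  kernel of \<open>P\<close>, and \<open>XV\<close> is X T = S X written through \<open>V\<close>
  and \<open>W\<close>.\<close>

locale contractive_intertwining =
  fixes V W P X :: "'a::complex_hilbert \<Rightarrow> 'a"
  assumes V: "complex_linear V" and norm_V: "\<And>x. norm (V x) = norm x"
    and W: "complex_linear W" and norm_W: "\<And>x. norm (W x) \<le> norm x"
    and P: "complex_linear P" and P_idem: "\<And>x. P (P x) = P x"
    and P_sym: "\<And>x y. inner (P x) y = inner x (P y)"
    and PWP: "\<And>x. P (W (P x)) = P (W x)"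
    and X: "complex_linear X" and PX: "\<And>x. P (X x) = X x"
    and XV: "\<And>x. X (V x) = P (W (X x))"
begin

lemmas linears = V[THEN complex_linear_imp_linear] W[THEN complex_linear_imp_linear]
  P[THEN complex_linear_imp_linear] X[THEN complex_linear_imp_linear]

lemmas linear_simps = linears[THEN linear_add] linears[THEN linear_diff] linears[THEN linear_scale]
  linears[THEN linear_0] linears[THEN linear_neg]

lemmas scaleC_simps = V[THEN complex_linear_scaleC] W[THEN complex_linear_scaleC]
  P[THEN complex_linear_scaleC] X[THEN complex_linear_scaleC]

lemma pythagoras: "(norm (P x))\<^sup>2 + (norm (x - P x))\<^sup>2 = (norm x)\<^sup>2"
proof -
  have "inner (P x) (P x) = inner x (P x)" by (simp add: P_sym P_idem)
  then show ?thesis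
    by (simp add: power2_norm_eq_inner inner_diff_left inner_diff_right inner_commute)
qed

lemma norm_P: "norm (P x) \<le> norm x"
  using pythagoras[of x] zero_le_power2[of "norm (x - P x)"]
  by (intro power2_le_imp_le[OF _ norm_ge_zero]) linarith

lemma norm_sum_PQ:
  assumes "P a = a" "P b = 0"
  shows "(norm (a + b))\<^sup>2 = (norm a)\<^sup>2 + (norm b)\<^sup>2"
  using pythagoras[of "a + b"] assms by (simp add: linear_simps)

text \<open>The lifting has the form \<open>Y = X + Z\<close> with \<open>P \<circ> Z = 0\<close>, and it is a contraction iff
  \<open>norm (Z k)\<^sup>2 \<le> defect k\<close> for all \<open>k\<close>.\<close>

definition defect :: "'a \<Rightarrow> real" where
  "defect k = (norm k)\<^sup>2 - (norm (X k))\<^sup>2"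

text \<open>Together with \<open>defect (V (R k)) \<le> defect k\<close> for the map
  \<open>R\<close> constructed next, this gives \<open>defect (R k) \<le> defect k\<close>, which
  controls the iteration.\<close>

lemma defect_le_defect_V: "defect k \<le> defect (V k)"
proof -
  have "norm (X (V k)) \<le> norm (X k)"
    unfolding XV using norm_P norm_W order_trans by blast
  then show ?thesis by (simp add: defect_def norm_V power_mono)
qed

text \<open>\<open>R\<close> is the orthogonal projection onto the range of \<open>V\<close> with respect to the form of
  \<open>defect\<close>, followed by the inverse of \<open>V\<close>.\<close>

lemma defect_projection_exists:
  assumes c: "0 \<le> c" "c < 1" and Xc: "\<And>k. norm (X k) \<le> c * norm k"
  obtains R where "complex_linear R" "\<And>k. R (V k) = k" "\<And>k. defect (V (R k)) \<le> defect k"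
proof -
  obtain V' where V': "\<And>x y. inner (V x) y = inner x (V' y)" "linear V'"
    "\<And>y. norm (V' y) \<le> 1 * norm y"
    using adjoint_exists[of V 1] linears norm_V by auto
  obtain X' where X': "\<And>x y. inner (X x) y = inner x (X' y)" "linear X'"
    "\<And>y. norm (X' y) \<le> c * norm y"
    using adjoint_exists[of X c] linears c Xc by metis
  \<comment> \<open>The hermitian form behind \<open>defect\<close>, real part only. Since
    \<open>c < 1\<close> it is positive definite, by \<open>defect_lower\<close>.\<close>
  define a where "a x y = inner x y - inner (X x) (X y)" for x y
  have a_lin: "a (x + y) z = a x z + a y z" "a (x - y) z = a x z - a y z"
      "a (r *\<^sub>R x) z = r * a x z" "a z (x - y) = a z x - a z y" for x y z r
    by (simp_all add: a_def linear_simps inner_add_left inner_diff_left inner_diff_right algebra_simps)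
  have a_sym: "a x y = a y x" for x y by (simp add: a_def inner_commute)
  have a_C: "a (scaleC d x) y = a x (scaleC (cnj d) y)" for d x y
    by (simp add: a_def inner_scaleC_left scaleC_simps)
  have a_self: "a x x = defect x" for x by (simp add: a_def defect_def power2_norm_eq_inner)
  have defect_lower: "(1 - c\<^sup>2) * (norm x)\<^sup>2 \<le> defect x" for x
  proof -
    have "(norm (X x))\<^sup>2 \<le> (c * norm x)\<^sup>2" using Xc by (simp add: power_mono)
    then show ?thesis by (simp add: defect_def power_mult_distrib algebra_simps)
  qed
  have c2: "c\<^sup>2 < 1" using c by (simp add: abs_square_less_1)
  have "\<exists>r. \<forall>l. a (V r) (V l) = a k (V l)" for k
  proof -
    \<comment> \<open>Since \<open>V'\<close> inverts \<open>V\<close> on the left, the normal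
      equation \<open>a (V r) (V l) = a k (V l)\<close> for all \<open>l\<close> says r = V' X' X V
      r + V' (k - X' X k). The right side contracts distances by c^2, so Banach's fixed point
      theorem solves it.\<close>
    define f where "f r = V' (X' (X (V r))) + (V' k - V' (X' (X k)))" for r
    have "dist (f r) (f s) \<le> c\<^sup>2 * dist r s" for r s
    proof -
      have "dist (f r) (f s) = norm (V' (X' (X (V (r - s)))))"
        by (simp add: f_def dist_norm linear_simps linear_diff[OF V'(2)] linear_diff[OF X'(2)])
      also have "\<dots> \<le> norm (X' (X (V (r - s))))" using V'(3) by simp
      also have "\<dots> \<le> c * norm (X (V (r - s)))" by (rule X'(3))
      also have "\<dots> \<le> c * (c * norm (V (r - s)))" by (intro mult_left_mono Xc c)
      finally show ?thesis by (simp add: norm_V dist_norm power2_eq_square mult.assoc)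
    qed
    then obtain r where r: "f r = r" using banach_fix_type[of "c\<^sup>2" f] c2 by auto
    have "a (V r) (V l) = a k (V l)" for l
    proof -
      have VV: "inner (V x) (V y) = inner x y" for x y
        unfolding dot_norm linear_simps(1)[symmetric] norm_V by (simp add: norm_V flip: linear_simps(1))
      have "inner l r = inner l (f r)" by (simp add: r)
      also have "\<dots> = inner (X (V l)) (X (V r)) + inner (V l) k - inner (X (V l)) (X k)"
        by (simp add: f_def V'(1) X'(1) inner_add_right inner_diff_right)
      finally show ?thesis by (simp add: a_def VV inner_commute)
    qed
    then show ?thesis by blast
  qed
  then obtain R where R: "\<And>k l. a (V (R k)) (V l) = a k (V l)" by metis
  \<comment> \<open>Definiteness makes the solution of the normal equation unique, which yields
    complex linearity of \<open>R\<close> and \<open>R (V k) = k\<close>.\<close>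
  have uniq: "r = s" if "\<And>l. a (V r) (V l) = a (V s) (V l)" for r s
  proof -
    have "defect (V (r - s)) = 0"
      using that[of "r - s"] by (simp add: linear_simps a_lin flip: a_self)
    then have "(1 - c\<^sup>2) * (norm (r - s))\<^sup>2 \<le> 0" using defect_lower[of "V (r - s)"] by (simp add: norm_V)
    then show ?thesis using c2 by (simp add: mult_le_0_iff)
  qed
  have "complex_linear R"
    unfolding complex_linear_def
  proof (intro conjI allI; rule uniq)
    show "a (V (R (x + y))) (V l) = a (V (R x + R y)) (V l)" for x y l
      by (simp add: linear_simps a_lin R)
    show "a (V (R (scaleC d x))) (V l) = a (V (scaleC d (R x))) (V l)" for d x l
    proof -
      have "a (V (R (scaleC d x))) (V l) = a x (V (scaleC (cnj d) l))"
        by (simp add: R a_C scaleC_simps)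
      also have "\<dots> = a (V (scaleC d (R x))) (V l)"
        using R[of x "scaleC (cnj d) l"] by (simp add: a_C scaleC_simps)
      finally show ?thesis .
    qed
  qed
  moreover have "R (V k) = k" for k by (rule uniq) (simp add: R)
  moreover have "defect (V (R k)) \<le> defect k" for k
  proof -
    \<comment> \<open>\<open>v\<close> is the projection of \<open>k\<close>, so the defects of
      \<open>v\<close> and \<open>k - v\<close> add up to that of \<open>k\<close>.\<close>
    define v where "v = V (R k)"
    have "a v v = a k v" using R[of k "R k"] by (simp add: v_def)
    then have "defect (k - v) = defect k - defect v"
      by (simp add: a_lin a_sym[of v k] flip: a_self)
    moreover have "defect (k - v) \<ge> 0"
      by (rule order_trans[OF _ defect_lower]) (use c2 in simp)
    ultimately show ?thesis by (simp add: v_def)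
  qed
  ultimately show thesis using that by blast
qed

text \<open>The gap \<open>c < 1\<close> supplies \<open>R\<close>. The error has two sources, the
  damping and stopping after finitely many iterations, and each is given half of
  \<open>eps\<close>.\<close>

lemma approximate_lifting:
  assumes c: "0 \<le> c" "c < 1" and Xc: "\<And>k. norm (X k) \<le> c * norm k" and eps: "eps > 0"
  obtains Y where "complex_linear Y" "\<And>k. norm (Y k) \<le> norm k" "\<And>k. P (Y k) = X k"
    "\<And>k. norm (Y (V k) - W (Y k)) \<le> eps * norm k"
proof -
  obtain R where R: "complex_linear R" and RV: "\<And>k. R (V k) = k"
    and defect_R: "\<And>k. defect (V (R k)) \<le> defect k"
    using defect_projection_exists[OF c Xc] by blast
  note R_simps = complex_linear_imp_linear[OF R, THEN linear_add] complex_linear_scaleC[OF R]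
  \<comment> \<open>The damping factor; the maximum with 0 covers \<open>eps > 2\<close>.\<close>
  define \<rho> where "\<rho> = max 0 (1 - eps / 2)"
  have \<rho>: "0 \<le> \<rho>" "\<rho> < 1" "1 - \<rho> \<le> eps / 2" using eps by (auto simp: \<rho>_def max_def)
  \<comment> \<open>Evaluating at \<open>R k\<close> extends the value prescribed at
    \<open>V k\<close> to the whole space. Subtracting \<open>P w\<close> keeps the part in the
    kernel of \<open>P\<close>.\<close>
  define \<Phi> where "\<Phi> Z k = (let w = W (X (R k) + \<rho> *\<^sub>R Z (R k)) in w - P w)" for Z and k :: 'a
  define Z where "Z n = (\<Phi> ^^ n) (\<lambda>_. 0)" for n
  have Z0: "Z 0 = (\<lambda>_. 0)" by (simp add: Z_def)
  have ZS: "Z (Suc n) k = W (X (R k) + \<rho> *\<^sub>R Z n (R k)) - P (W (X (R k) + \<rho> *\<^sub>R Z n (R k)))" for n k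
    by (simp add: Z_def \<Phi>_def Let_def)
  have lin: "complex_linear (Z n)" for n
  proof (induction n)
    case (Suc n)
    note IH = complex_linear_imp_linear[OF Suc, THEN linear_add] complex_linear_scaleC[OF Suc]
    show ?case unfolding complex_linear_def
      by (simp add: ZS R_simps IH linear_simps scaleC_simps scaleC_add_right scaleC_scaleR
          linear_diff[OF linear_scaleC] algebra_simps)
  qed (simp add: Z0 complex_linear_def linear_0[OF linear_scaleC])
  have PZ: "P (Z n k) = 0" for n k
    by (cases n) (simp_all add: Z0 ZS linear_simps P_idem)
  \<comment> \<open>\<open>W\<close> preserves the kernel of \<open>P\<close>, so the
    \<open>Z\<close>-term does not affect the \<open>P\<close>-component, which \<open>XV\<close>
    identifies.\<close>
  have PWZ: "P (W (X x + t *\<^sub>R Z n y)) = X (V x)" for x t n y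
    by (subst PWP[symmetric]) (simp add: linear_simps PX PZ XV)
  \<comment> \<open>Invariance of the ball: |Z (Suc n) k|^2 = |W u|^2 - |X (V (R k))|^2, and by
    induction |W u| is at most |R k| = |V (R k)|, so the bound is
    \<open>defect (V (R k))\<close>.\<close>
  have bound: "(norm (Z n k))\<^sup>2 \<le> defect k" for n k
  proof (induction n arbitrary: k)
    case 0
    have "norm (X k) \<le> norm k" using c by (intro order_trans[OF Xc] mult_left_le_one_le) auto
    then show ?case by (simp add: Z0 defect_def power_mono)
  next
    case (Suc n)
    define u where "u = X (R k) + \<rho> *\<^sub>R Z n (R k)"
    have "(norm u)\<^sup>2 = (norm (X (R k)))\<^sup>2 + \<rho>\<^sup>2 * (norm (Z n (R k)))\<^sup>2"
      unfolding u_def by (subst norm_sum_PQ) (simp_all add: PX PZ linear_simps power_mult_distrib)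
    also have "\<dots> \<le> (norm (X (R k)))\<^sup>2 + 1 * (norm (Z n (R k)))\<^sup>2"
      using \<rho> by (intro add_left_mono mult_right_mono) (auto simp: power_le_one)
    also have "\<dots> \<le> (norm (R k))\<^sup>2" using Suc[of "R k"] by (simp add: defect_def)
    finally have u: "(norm (W u))\<^sup>2 \<le> (norm (R k))\<^sup>2"
      using power_mono[OF norm_W[of u], of 2] by simp
    have "(norm (Z (Suc n) k))\<^sup>2 = (norm (W u))\<^sup>2 - (norm (X (V (R k))))\<^sup>2"
      using pythagoras[of "W u"] by (simp add: ZS u_def PWZ)
    also have "\<dots> \<le> defect (V (R k))" using u by (simp add: defect_def norm_V)
    finally show ?case using defect_R[of k] by simp
  qed
  \<comment> \<open>The \<open>P\<close>-components cancel, so each increment is \<open>W\<close>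
    applied to \<rho> times the previous one at \<open>R k\<close>.\<close>
  have diff: "(norm (Z (Suc n) k - Z n k))\<^sup>2 \<le> (\<rho> ^ n)\<^sup>2 * defect k" for n k
  proof (induction n arbitrary: k)
    case 0
    then show ?case using bound[of 1 k] by (simp add: Z0)
  next
    case (Suc n)
    define d where "d = Z (Suc n) (R k) - Z n (R k)"
    have "Z (Suc (Suc n)) k - Z (Suc n) k = W (\<rho> *\<^sub>R d)"
      unfolding ZS[of "Suc n" k] ZS[of n k] PWZ by (simp add: d_def linear_simps algebra_simps)
    then have "(norm (Z (Suc (Suc n)) k - Z (Suc n) k))\<^sup>2 \<le> \<rho>\<^sup>2 * (norm d)\<^sup>2"
      using power_mono[OF norm_W[of "\<rho> *\<^sub>R d"], of 2] by (simp add: power_mult_distrib)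
    also have "\<dots> \<le> \<rho>\<^sup>2 * ((\<rho> ^ n)\<^sup>2 * defect (R k))"
      unfolding d_def by (intro mult_left_mono Suc) simp
    also have "\<dots> \<le> \<rho>\<^sup>2 * ((\<rho> ^ n)\<^sup>2 * defect k)"
      using defect_le_defect_V[of "R k"] defect_R[of k] by (intro mult_left_mono) auto
    finally show ?case by (simp add: power_mult_distrib algebra_simps)
  qed
  have defect_le: "defect k \<le> (norm k)\<^sup>2" for k by (simp add: defect_def)
  obtain n where n: "\<rho> ^ n < eps / 2" using real_arch_pow_inv[of "eps / 2" \<rho>] \<rho> eps by auto
  \<comment> \<open>With index \<open>Suc n\<close> one gets
    \<open>Y (V k) = W (X k + \<rho> *\<^sub>R Z n k)\<close> exactly, so
    \<open>Y (V k) - W (Y k)\<close> consists only of the damping term and the last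
    increment.\<close>
  define Y where "Y k = X k + Z (Suc n) k" for k
  have "complex_linear Y"
    using X lin[of "Suc n"] by (auto simp: Y_def complex_linear_def scaleC_add_right)
  moreover have "norm (Y k) \<le> norm k" for k
  proof (rule power2_le_imp_le)
    show "(norm (Y k))\<^sup>2 \<le> (norm k)\<^sup>2"
      unfolding Y_def using bound[of "Suc n" k] by (subst norm_sum_PQ) (auto simp: PX PZ defect_def)
  qed simp
  moreover have "P (Y k) = X k" for k by (simp add: Y_def linear_simps PX PZ)
  moreover have "norm (Y (V k) - W (Y k)) \<le> eps * norm k" for k
  proof -
    have Zk: "norm (Z n k) \<le> norm k"
      by (rule power2_le_imp_le[OF order_trans[OF bound defect_le]]) simp
    have dk: "norm (Z (Suc n) k - Z n k) \<le> \<rho> ^ n * norm k"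
    proof (rule power2_le_imp_le)
      show "(norm (Z (Suc n) k - Z n k))\<^sup>2 \<le> (\<rho> ^ n * norm k)\<^sup>2"
        unfolding power_mult_distrib by (rule order_trans[OF diff mult_left_mono[OF defect_le]]) simp
    qed (use \<rho> in simp)
    have "Y (V k) = W (X k + \<rho> *\<^sub>R Z n k)"
      unfolding Y_def ZS RV PWZ by simp
    then have "Y (V k) - W (Y k) = W ((\<rho> - 1) *\<^sub>R Z n k - (Z (Suc n) k - Z n k))"
      by (simp add: Y_def linear_simps algebra_simps)
    also have "norm \<dots> \<le> norm ((\<rho> - 1) *\<^sub>R Z n k) + norm (Z (Suc n) k - Z n k)"
      by (rule order_trans[OF norm_W norm_triangle_ineq4])
    also have "\<dots> \<le> (1 - \<rho>) * norm k + \<rho> ^ n * norm k"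
      using \<rho> Zk dk by (intro add_mono) (auto intro: mult_left_mono)
    also have "\<dots> \<le> (eps / 2) * norm k + (eps / 2) * norm k"
      using \<rho> n by (intro add_mono mult_right_mono) auto
    finally show ?thesis by simp
  qed
  ultimately show thesis using that by blast
qed

section \<open>Rescaling and passage to the weak limit\<close>

lemma scaled: "contractive_intertwining V W P (\<lambda>k. r *\<^sub>R X k)"
  by unfold_locales
    (auto simp: V W P norm_V norm_W P_idem P_sym PWP PX XV linear_simps complex_linear_def
      scaleC_simps scaleC_scaleR algebra_simps)

text \<open>Shrinking \<open>X\<close> by \<open>1 - e n\<close> creates the gap needed for an
  approximate lifting. As \<open>e n\<close> tends to 0, both the shrinking and the intertwining
  error disappear in a weak limit.\<close>

theorem contractive_lifting_exists:
  assumes norm_X: "\<And>k. norm (X k) \<le> norm k"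
  obtains Y where "complex_linear Y" "\<And>k. norm (Y k) \<le> norm k" "\<And>k. P (Y k) = X k"
    "\<And>k. Y (V k) = W (Y k)"
proof -
  define e where "e n = inverse (real (Suc n))" for n
  have e: "0 < e n" "e n \<le> 1" for n by (simp_all add: e_def inverse_le_1_iff)
  have e_lim: "e \<longlonglongrightarrow> 0" unfolding e_def by (rule LIMSEQ_inverse_real_of_nat)
  have "\<exists>Y. complex_linear Y \<and> (\<forall>k. norm (Y k) \<le> norm k) \<and> (\<forall>k. P (Y k) = (1 - e n) *\<^sub>R X k) \<and>
      (\<forall>k. norm (Y (V k) - W (Y k)) \<le> e n * norm k)" for n
  proof -
    interpret sc: contractive_intertwining V W P "\<lambda>k. (1 - e n) *\<^sub>R X k" by (rule scaled)
    have "norm ((1 - e n) *\<^sub>R X k) \<le> (1 - e n) * norm k" for k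
      using e[of n] norm_X by (simp add: mult_left_mono)
    then show ?thesis using sc.approximate_lifting[of "1 - e n" "e n"] e[of n] by (metis diff_ge_0_iff_ge
        diff_less_eq less_add_same_cancel1)
  qed
  then obtain Y where lin: "\<And>n. complex_linear (Y n)" and norm_Y: "\<And>n k. norm (Y n k) \<le> norm k"
    and PY: "\<And>n k. P (Y n k) = (1 - e n) *\<^sub>R X k"
    and comm: "\<And>n k. norm (Y n (V k) - W (Y n k)) \<le> e n * norm k" by metis
  obtain F L where F: "F \<noteq> bot" "F \<le> sequentially"
    and lim: "\<And>k l. ((\<lambda>n. inner l (Y n k)) \<longlongrightarrow> inner l (L k)) F"
    and L: "linear L" "\<And>k. norm (L k) \<le> norm k"
    using contractions_weak_cluster_point[of Y] lin norm_Y complex_linear_imp_linear by metis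
  note uniq = tendsto_unique[OF F(1)]
  have e_lim: "(e \<longlongrightarrow> 0) F" using e_lim F(2) tendsto_mono by blast
  have "L (scaleC c k) = scaleC c (L k)" for c k
  proof (rule inner_eq_all_imp_eq, rule uniq[OF lim])
    fix l :: 'a
    have "inner l (scaleC c x) = inner (scaleC (cnj c) l) x" for x by (simp add: inner_scaleC_left)
    then show "((\<lambda>n. inner l (Y n (scaleC c k))) \<longlongrightarrow> inner l (scaleC c (L k))) F"
      by (simp add: complex_linear_scaleC[OF lin] lim)
  qed
  then have "complex_linear L" using L by (intro complex_linearI)
  moreover have "P (L k) = X k" for k
  proof (rule inner_eq_all_imp_eq)
    fix l
    have "((\<lambda>n. (1 - e n) * inner l (X k)) \<longlongrightarrow> (1 - 0) * inner l (X k)) F"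
      by (intro tendsto_intros e_lim)
    moreover have "(\<lambda>n. (1 - e n) * inner l (X k)) = (\<lambda>n. inner (P l) (Y n k))"
      by (simp add: P_sym PY)
    ultimately show "inner l (P (L k)) = inner l (X k)"
      using uniq[OF lim[of "P l" k]] by (simp add: P_sym)
  qed
  moreover have "L (V k) = W (L k)" for k
  proof (rule inner_eq_all_imp_eq)
    fix l
    \<comment> \<open>Weak convergence only tests \<open>Y n k\<close> against fixed vectors, so
      \<open>W\<close> has to be moved to the other side.\<close>
    obtain W' where W': "\<And>x y. inner (W x) y = inner x (W' y)"
      using adjoint_exists[of W 1] linears(2) norm_W by (metis mult_1 zero_le_one)
    then have W': "inner y (W x) = inner (W' y) x" for x y by (metis inner_commute)
    have "((\<lambda>n. inner l (Y n (V k)) - inner l (W (Y n k))) \<longlongrightarrow> inner l (L (V k)) - inner l (W (L k))) F"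
      unfolding W' by (intro tendsto_intros lim)
    moreover have "((\<lambda>n. inner l (Y n (V k)) - inner l (W (Y n k))) \<longlongrightarrow> 0) F"
    proof (rule Lim_null_comparison[OF always_eventually])
      show "\<forall>n. norm (inner l (Y n (V k)) - inner l (W (Y n k))) \<le> norm l * (e n * norm k)"
      proof
        fix n
        have "\<bar>inner l (Y n (V k) - W (Y n k))\<bar> \<le> norm l * norm (Y n (V k) - W (Y n k))"
          by (rule Cauchy_Schwarz_ineq2)
        also have "\<dots> \<le> norm l * (e n * norm k)" by (intro mult_left_mono comm) simp
        finally show "norm (inner l (Y n (V k)) - inner l (W (Y n k))) \<le> norm l * (e n * norm k)"
          by (simp add: inner_diff_right)
      qed
      show "((\<lambda>n. norm l * (e n * norm k)) \<longlongrightarrow> 0) F"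
        by (intro tendsto_mult_right_zero tendsto_mult_left_zero e_lim)
    qed
    ultimately have "inner l (L (V k)) - inner l (W (L k)) = 0" by (rule uniq)
    then show "inner l (L (V k)) = inner l (W (L k))" by simp
  qed
  ultimately show thesis using that L(2) by blast
qed

theorem lifting_exists:
  assumes M: "M \<ge> 0" and norm_X: "\<And>k. norm (X k) \<le> M * norm k"
  obtains Y where "complex_linear Y" "\<And>k. norm (Y k) \<le> M * norm k" "\<And>k. P (Y k) = X k"
    "\<And>k. Y (V k) = W (Y k)"
proof (cases "M = 0")
  case True
  then show thesis
    using norm_X by (intro that[of "\<lambda>_. 0"])
      (auto simp: complex_linear_def linear_simps linear_0[OF linear_scaleC])
next
  case False
  interpret sc: contractive_intertwining V W P "\<lambda>k. inverse M *\<^sub>R X k" by (rule scaled)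
  have "norm (inverse M *\<^sub>R X k) \<le> norm k" for k
    using norm_X[of k] False M by (simp add: field_simps)
  then obtain Y where Y: "complex_linear Y" "\<And>k. norm (Y k) \<le> norm k"
    "\<And>k. P (Y k) = inverse M *\<^sub>R X k" "\<And>k. Y (V k) = W (Y k)"
    using sc.contractive_lifting_exists by blast
  show thesis
  proof (rule that[of "\<lambda>k. M *\<^sub>R Y k"])
    show "complex_linear (\<lambda>k. M *\<^sub>R Y k)"
      using Y(1) by (simp add: complex_linear_def scaleC_scaleR scaleR_add_right)
  qed (use Y M False in \<open>simp_all add: linear_simps mult_left_mono\<close>)
qed

end

section \<open>Closed subspaces and liftings\<close>

text \<open>\<open>H\<close> is closed under multiplication by \<i>, so vanishing of the real parts
  forces the imaginary parts to vanish.\<close>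

lemma orthocompl_iff:
  assumes "csubspace H"
  shows "y \<in> orthocompl H \<longleftrightarrow> (\<forall>x\<in>H. inner x y = 0)"
proof -
  have "inner x (scaleC \<i> y) = 0" if "\<forall>x\<in>H. inner x y = 0" "x \<in> H" for x
  proof -
    have "scaleC \<i> x \<in> H" using assms that(2) by (simp add: csubspace_def)
    then show ?thesis using that(1) inner_scaleC_ii[of x y] by simp
  qed
  then show ?thesis by (auto simp: orthocompl_def cinner_def complex_eq_iff)
qed

lemma csubspace_imp_subspace: "csubspace H \<Longrightarrow> subspace H"
  unfolding csubspace_def subspace_def by (metis scaleC_of_real)

lemma csubspace_orthocompl:
  assumes "csubspace H"
  shows "csubspace (orthocompl H)"
proof -
  have "inner x (scaleC c y) = 0" if "\<forall>x\<in>H. inner x y = 0" "x \<in> H" for x y c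
  proof -
    have "scaleC (cnj c) x \<in> H" using assms that(2) by (simp add: csubspace_def)
    then show ?thesis using that(1) inner_scaleC_left[of "cnj c" x y] by simp
  qed
  then show ?thesis
    unfolding csubspace_def[of "orthocompl H"] by (simp add: orthocompl_iff[OF assms] inner_add_right)
qed

section \<open>Projection onto a closed complex subspace, and liftings\<close>

context
  fixes H :: "'a::complex_hilbert set"
  assumes H: "closed_csubspace H"
begin

private lemma csub: "csubspace H" and cl: "closed H" and sub: "subspace H"
  and osub: "subspace (orthocompl H)"
  using H csubspace_imp_subspace csubspace_orthocompl by (auto simp: closed_csubspace_def)

lemma proj_eqI:
  assumes "h \<in> H" "x - h \<in> orthocompl H"
  shows "proj H x = h"
  unfolding proj_def
proof (rule the_equality)
  fix g assume g: "g \<in> H \<and> x - g \<in> orthocompl H"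
  have "(x - h) - (x - g) \<in> orthocompl H" using assms g osub by (blast intro: subspace_diff)
  moreover have "g - h \<in> H" using assms g sub by (blast intro: subspace_diff)
  ultimately have "inner (g - h) (g - h) = 0" using orthocompl_iff[OF csub] by simp
  then show "g = h" by simp
qed (use assms in simp)

lemma proj_in: "proj H x \<in> H" and diff_proj_in: "x - proj H x \<in> orthocompl H"
proof -
  obtain p where "p \<in> H" "\<And>s. s \<in> H \<Longrightarrow> inner s (x - p) = 0"
    using orthogonal_projection_exists[OF sub cl] by blast
  then have "p \<in> H" "x - p \<in> orthocompl H" by (auto simp: orthocompl_iff[OF csub])
  then show "proj H x \<in> H" "x - proj H x \<in> orthocompl H" using proj_eqI by auto
qed

lemma proj_of_mem: "x \<in> H \<Longrightarrow> proj H x = x"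
  by (rule proj_eqI) (use subspace_0[OF osub] in auto)

lemma proj_of_orthocompl: "x \<in> orthocompl H \<Longrightarrow> proj H x = 0"
  by (rule proj_eqI) (use subspace_0[OF sub] in auto)

lemma proj_eq_0_imp_orthocompl: "proj H x = 0 \<Longrightarrow> x \<in> orthocompl H"
  using diff_proj_in[of x] by simp

lemma complex_linear_proj: "complex_linear (proj H)"
  unfolding complex_linear_def
proof (intro conjI allI; rule proj_eqI)
  fix x y c
  show "proj H x + proj H y \<in> H" using sub proj_in by (simp add: subspace_add)
  show "x + y - (proj H x + proj H y) \<in> orthocompl H"
    using subspace_add[OF osub diff_proj_in diff_proj_in] by (simp add: algebra_simps)
  show "scaleC c (proj H x) \<in> H" using csub proj_in by (simp add: csubspace_def)
  show "scaleC c x - scaleC c (proj H x) \<in> orthocompl H"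
    using csubspace_orthocompl[OF csub] diff_proj_in[of x]
    by (simp add: csubspace_def flip: linear_diff[OF linear_scaleC])
qed

lemma inner_proj_commute: "inner (proj H x) y = inner x (proj H y)"
proof -
  have *: "inner (proj H a) (b - proj H b) = 0" for a b
    using proj_in[of a] diff_proj_in[of b] by (simp add: orthocompl_iff[OF csub])
  have "inner (x - proj H x) (proj H y) = 0" using *[of y x] by (simp add: inner_commute)
  then show ?thesis using *[of x y] by (simp add: inner_diff_left inner_diff_right)
qed

lemma norm_proj_le: "norm (proj H x) \<le> norm x"
proof (cases "proj H x = 0")
  case False
  have "norm (proj H x) * norm (proj H x) = inner (proj H x) x"
    using inner_proj_commute[of "proj H x" x]
    by (simp add: proj_of_mem proj_in power2_norm_eq_inner flip: power2_eq_square)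
  also have "\<dots> \<le> norm (proj H x) * norm x" by (rule norm_cauchy_schwarz)
  finally show ?thesis using False by simp
qed simp

text \<open>The definition gives this on \<open>H\<close>; on the orthogonal complement both sides
  vanish. In this form the relation iterates, which yields the power formulas.\<close>

lemma lifting_proj:
  assumes "lifting H T S"
  shows "proj H (S k) = T (proj H k)"
proof -
  have S: "bounded_op_on UNIV S" "S ` orthocompl H \<subseteq> orthocompl H"
    "T (proj H k) = proj H (S (proj H k))"
    using assms proj_in by (simp_all add: lifting_def)
  have add: "S (proj H k + (k - proj H k)) = S (proj H k) + S (k - proj H k)"
    using S(1) unfolding bounded_op_on_def by blast
  have "S (k - proj H k) \<in> orthocompl H" using S(2) diff_proj_in by blast
  then have "proj H (S (k - proj H k)) = 0" by (rule proj_of_orthocompl)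
  then show ?thesis
    using S(3) add linear_add[OF complex_linear_imp_linear[OF complex_linear_proj]] by simp
qed

lemma proj_funpow_lifting:
  assumes "lifting H T S"
  shows "proj H ((S ^^ n) k) = (T ^^ n) (proj H k)"
  by (induction n) (simp_all add: lifting_proj[OF assms])

lemma proj_funpow_lifting2:
  assumes "lifting H T S" "lifting H X Y" "h \<in> H"
  shows "(T ^^ n) ((X ^^ m) h) = proj H ((S ^^ n) ((Y ^^ m) h))"
  using assms by (simp add: proj_funpow_lifting proj_of_mem)

lemma reduces_proj:
  assumes "bounded_op_on UNIV S" "reduces H S"
  shows "proj H (S k) = S (proj H k)"
proof (rule proj_eqI)
  show "S (proj H k) \<in> H" using assms(2) proj_in by (auto simp: reduces_def)
  have "S (proj H k + (k - proj H k)) = S (proj H k) + S (k - proj H k)"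
    using assms(1) unfolding bounded_op_on_def by blast
  then show "S k - S (proj H k) \<in> orthocompl H"
    using assms(2) diff_proj_in[of k] by (auto simp: reduces_def)
qed

end

section \<open>Boundedness and operator norms\<close>

lemma bounded_op_on_UNIV_iff:
  "bounded_op_on UNIV f \<longleftrightarrow> complex_linear f \<and> (\<exists>B. \<forall>x. norm (f x) \<le> B * norm x)"
  by (auto simp: bounded_op_on_def complex_linear_def)

lemma opnorm_on_upper:
  assumes "bounded_op_on S f" "x \<in> S" "0 \<in> S"
  shows "norm (f x) \<le> opnorm_on S f * norm x" and "opnorm_on S f \<ge> 0"
proof -
  obtain B where B: "\<forall>x\<in>S. norm (f x) \<le> B * norm x" using assms(1) by (auto simp: bounded_op_on_def)
  have "bdd_above ((\<lambda>x. norm (f x) / norm x) ` S)"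
  proof (rule bdd_aboveI2)
    \<comment> \<open>At \<open>x = 0\<close> the quotient is 0 by convention, while
      \<open>B\<close> may be negative if \<open>S\<close> is trivial.\<close>
    show "norm (f x) / norm x \<le> max B 0" if "x \<in> S" for x
    proof (cases "x = 0")
      case False
      then have "norm (f x) / norm x \<le> B" using B that by (simp add: divide_le_eq)
      then show ?thesis by simp
    qed simp
  qed
  then have *: "norm (f x) / norm x \<le> opnorm_on S f" if "x \<in> S" for x
    unfolding opnorm_on_def using that by (rule cSUP_upper2) simp_all
  show "opnorm_on S f \<ge> 0" using *[OF assms(3)] by simp
  show "norm (f x) \<le> opnorm_on S f * norm x"
    using *[OF assms(2)] B assms(2) by (cases "x = 0") (auto simp: field_simps)
qed

lemma opnorm_on_least:
  assumes "S \<noteq> {}" "M \<ge> 0" "\<And>x. x \<in> S \<Longrightarrow> norm (f x) \<le> M * norm x"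
  shows "opnorm_on S f \<le> M"
  unfolding opnorm_on_def
proof (rule cSUP_least[OF assms(1)])
  show "norm (f x) / norm x \<le> M" if "x \<in> S" for x
    using assms that by (cases "x = 0") (auto simp: field_simps)
qed

text \<open>Applies the locale to \<open>X\<close> preceded by the projection, with bound
  \<open>opnorm_on H X\<close>. The reverse norm inequality holds because \<open>X\<close> is a
  compression of \<open>Y\<close>.\<close>

theorem intertwining_lifting:
  fixes H :: "'a::complex_hilbert set"
  assumes H: "closed_csubspace H"
    and V: "isometry_on UNIV V" and W: "contraction_on UNIV W"
    and X: "bounded_op_on H X"
    and W_orth: "W ` orthocompl H \<subseteq> orthocompl H"
    and XV: "\<And>k. X (proj H (V k)) = proj H (W (X (proj H k)))"
  obtains Y where "lifting H X Y" "\<And>k. Y (V k) = W (Y k)" "opnorm_on UNIV Y = opnorm_on H X"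
proof -
  have H0: "0 \<in> H" using H by (simp add: closed_csubspace_def csubspace_def)
  have XH: "X h \<in> H" if "h \<in> H" for h using X that by (auto simp: bounded_op_on_def)
  note X_bound = opnorm_on_upper[OF X _ H0]
  define M where "M = opnorm_on H X"
  have M: "M \<ge> 0" using X_bound(2)[OF H0] by (simp add: M_def)
  have linW: "complex_linear W" using W by (simp add: contraction_on_def bounded_op_on_UNIV_iff)
  note linP = complex_linear_proj[OF H]
  note diffs = linP[THEN complex_linear_imp_linear, THEN linear_diff]
    linW[THEN complex_linear_imp_linear, THEN linear_diff]
  interpret contractive_intertwining V W "proj H" "\<lambda>k. X (proj H k)"
  proof
    show "complex_linear V" "\<And>x. norm (V x) = norm x"
      using V by (auto simp: isometry_on_def bounded_op_on_UNIV_iff)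
    show "complex_linear W" "\<And>x. norm (W x) \<le> norm x"
      using W by (auto simp: contraction_on_def bounded_op_on_UNIV_iff)
    show "complex_linear (\<lambda>k. X (proj H k))"
      using X linP proj_in[OF H] by (simp add: complex_linear_def bounded_op_on_def)
    show "proj H (W (proj H x)) = proj H (W x)" for x
    proof -
      have "W (x - proj H x) \<in> orthocompl H" using W_orth diff_proj_in[OF H] by blast
      then have "proj H (W (x - proj H x)) = 0" by (rule proj_of_orthocompl[OF H])
      then show ?thesis by (simp add: diffs)
    qed
  qed (simp_all add: linP proj_of_mem[OF H] proj_in[OF H] XH inner_proj_commute[OF H] XV)
  have "norm (X (proj H k)) \<le> M * norm k" for k
    using X_bound(1)[OF proj_in[OF H], of k] mult_left_mono[OF norm_proj_le[OF H, of k] M]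
    unfolding M_def by linarith
  then obtain Y where Y: "complex_linear Y" "\<And>k. norm (Y k) \<le> M * norm k"
    "\<And>k. proj H (Y k) = X (proj H k)" "\<And>k. Y (V k) = W (Y k)"
    using lifting_exists[OF M] by blast
  have bY: "bounded_op_on UNIV Y" using Y(1,2) bounded_op_on_UNIV_iff by blast
  \<comment> \<open>Needed for \<open>Y\<close> to preserve the orthogonal complement: there
    \<open>proj H (Y k) = X 0\<close>.\<close>
  have "X 0 = 0" using X_bound(1)[OF H0] by simp
  then have "lifting H X Y"
    using bY Y(3) proj_of_orthocompl[OF H] proj_of_mem[OF H]
    by (auto simp: lifting_def intro!: proj_eq_0_imp_orthocompl[OF H])
  moreover have "opnorm_on UNIV Y = opnorm_on H X"
  proof (rule antisym)
    show "opnorm_on UNIV Y \<le> opnorm_on H X"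
      using Y(2) M by (intro opnorm_on_least) (auto simp: M_def)
    show "opnorm_on H X \<le> opnorm_on UNIV Y"
    proof (rule opnorm_on_least)
      show "opnorm_on UNIV Y \<ge> 0" using opnorm_on_upper[OF bY] by simp
      show "norm (X h) \<le> opnorm_on UNIV Y * norm h" if "h \<in> H" for h
      proof -
        have "norm (X h) = norm (proj H (Y h))" using Y(3)[of h] proj_of_mem[OF H that] by simp
        also have "\<dots> \<le> norm (Y h)" by (rule norm_proj_le[OF H])
        also have "\<dots> \<le> opnorm_on UNIV Y * norm h" using opnorm_on_upper[OF bY] by simp
        finally show ?thesis .
      qed
    qed (use H0 in blast)
  qed
  ultimately show thesis using that Y(4) by blast
qed

section \<open>The three twisted commutation relations\<close>

lemma contraction_on_UNIV_iff:
  "contraction_on UNIV f \<longleftrightarrow> complex_linear f \<and> (\<forall>x. norm (f x) \<le> norm x)"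
  by (auto simp: contraction_on_def bounded_op_on_UNIV_iff intro!: exI[of _ 1])

lemma isometry_on_UNIV_iff:
  "isometry_on UNIV f \<longleftrightarrow> complex_linear f \<and> (\<forall>x. norm (f x) = norm x)"
  by (auto simp: isometry_on_def bounded_op_on_UNIV_iff intro!: exI[of _ 1])

lemma complex_linear_compose:
  "complex_linear f \<Longrightarrow> complex_linear g \<Longrightarrow> complex_linear (\<lambda>x. f (g x))"
  by (simp add: complex_linear_def)

lemma unitary_on_UNIV_inverse:
  assumes "unitary_on UNIV U"
  obtains U' where "isometry_on UNIV U'" "\<And>x. U (U' x) = x" "\<And>x. U' (U x) = x"
proof -
  have lin: "complex_linear U" and n: "\<And>x. norm (U x) = norm x" and s: "surj U"
    using assms by (auto simp: unitary_on_def isometry_on_UNIV_iff)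
  have "inj U"
  proof (rule injI)
    fix x y assume "U x = U y"
    then have "norm (U (x - y)) = 0" by (simp add: linear_diff[OF complex_linear_imp_linear[OF lin]])
    then show "x = y" by (simp add: n)
  qed
  have UU: "U (inv U x) = x" for x using s by (simp add: surj_f_inv_f)
  have "complex_linear (inv U)"
    unfolding complex_linear_def
    by (metis \<open>inj U\<close> UU inv_f_f lin[unfolded complex_linear_def])
  moreover have "norm (inv U x) = norm x" for x using n[of "inv U x"] by (simp add: UU)
  ultimately show thesis using that[of "inv U"] \<open>inj U\<close> UU by (simp add: isometry_on_UNIV_iff)
qed

theorem mainTheorem3:
  fixes H :: "'k::complex_hilbert set"
    and T X Q V Qb :: "'k \<Rightarrow> 'k"
  assumes H: "closed_csubspace H"
    and T: "contraction_on H T"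
    and V: "isometric_lifting H T V"
    and X: "bounded_op_on H X"
    and Q: "contraction_on H Q"
    and Qb: "contraction_on UNIV Qb"
    and red: "reduces H Qb"
    and restr: "\<forall>h\<in>H. Qb h = Q h"
  shows
    "((\<forall>h\<in>H. X (T h) = Q (T (X h))) \<longrightarrow>
       (\<exists>Y. lifting H X Y \<and> (\<forall>k. Y (V k) = Qb (V (Y k)))
          \<and> (\<forall>n m. \<forall>h\<in>H. (T ^^ n) ((X ^^ m) h) = proj H ((V ^^ n) ((Y ^^ m) h)))
          \<and> (\<forall>n m. \<forall>h\<in>H. (X ^^ n) ((T ^^ m) h) = proj H ((Y ^^ n) ((V ^^ m) h)))
          \<and> opnorm_on UNIV Y = opnorm_on H X))
   \<and> ((\<forall>h\<in>H. X (T h) = T (Q (X h))) \<longrightarrow>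
       (\<exists>Y. lifting H X Y \<and> (\<forall>k. Y (V k) = V (Qb (Y k)))
          \<and> (\<forall>n m. \<forall>h\<in>H. (T ^^ n) ((X ^^ m) h) = proj H ((V ^^ n) ((Y ^^ m) h)))
          \<and> (\<forall>n m. \<forall>h\<in>H. (X ^^ n) ((T ^^ m) h) = proj H ((Y ^^ n) ((V ^^ m) h)))
          \<and> opnorm_on UNIV Y = opnorm_on H X))
   \<and> ((unitary_on H Q \<and> unitary_on UNIV Qb \<and> (\<forall>h\<in>H. X (T h) = T (X (Q h)))) \<longrightarrow>
       (\<exists>Y. lifting H X Y \<and> (\<forall>k. Y (V k) = V (Y (Qb k)))
          \<and> (\<forall>n m. \<forall>h\<in>H. (T ^^ n) ((X ^^ m) h) = proj H ((V ^^ n) ((Y ^^ m) h)))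
          \<and> (\<forall>n m. \<forall>h\<in>H. (X ^^ n) ((T ^^ m) h) = proj H ((Y ^^ n) ((V ^^ m) h)))
          \<and> opnorm_on UNIV Y = opnorm_on H X))"
proof -
  have liftV: "lifting H T V" and isoV: "isometry_on UNIV V"
    using V by (auto simp: isometric_lifting_def)
  have V_orth: "V ` orthocompl H \<subseteq> orthocompl H" using liftV by (simp add: lifting_def)
  have Qb_orth: "Qb ` orthocompl H \<subseteq> orthocompl H" using red by (simp add: reduces_def)
  have XH: "X h \<in> H" if "h \<in> H" for h using X that by (auto simp: bounded_op_on_def)
  have TH: "T h \<in> H" if "h \<in> H" for h using T that by (auto simp: contraction_on_def bounded_op_on_def)
  have linV: "complex_linear V" and norm_V: "\<And>x. norm (V x) = norm x"
    using isoV by (auto simp: isometry_on_UNIV_iff)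
  have linQ: "complex_linear Qb" and norm_Q: "\<And>x. norm (Qb x) \<le> norm x"
    using Qb by (auto simp: contraction_on_UNIV_iff)
  have projQ: "proj H (Qb k) = Qb (proj H k)" for k
    using reduces_proj[OF H _ red] Qb by (simp add: contraction_on_def)
  note projV = lifting_proj[OF H liftV]
  note P_in = proj_in[OF H] and P_mem = proj_of_mem[OF H]
  have powers: "(\<forall>n m. \<forall>h\<in>H. (T ^^ n) ((X ^^ m) h) = proj H ((V ^^ n) ((Y ^^ m) h)))
      \<and> (\<forall>n m. \<forall>h\<in>H. (X ^^ n) ((T ^^ m) h) = proj H ((Y ^^ n) ((V ^^ m) h)))"
    if "lifting H X Y" for Y
    using proj_funpow_lifting2[OF H liftV that] proj_funpow_lifting2[OF H that liftV] by simp
  have twisted_left: "\<exists>Y. lifting H X Y \<and> (\<forall>k. Y (V k) = Qb (V (Y k))) \<and> opnorm_on UNIV Y = opnorm_on H X"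
    if eq: "\<forall>h\<in>H. X (T h) = Q (T (X h))"
  proof -
    have "contraction_on UNIV (\<lambda>k. Qb (V k))"
      using complex_linear_compose[OF linQ linV] norm_Q norm_V by (metis contraction_on_UNIV_iff)
    moreover have "(\<lambda>k. Qb (V k)) ` orthocompl H \<subseteq> orthocompl H" using V_orth Qb_orth by blast
    moreover have "X (proj H (V k)) = proj H (Qb (V (X (proj H k))))" for k
      \<comment> \<open>\<open>Qb\<close> commutes with the projection, so \<open>Qb V\<close>
        compresses to \<open>Q T\<close> on \<open>H\<close>.\<close>
      using eq restr by (simp add: projV projQ P_in P_mem XH TH)
    ultimately show ?thesis using intertwining_lifting[OF H isoV _ X] by metis
  qed
  have twisted_middle: "\<exists>Y. lifting H X Y \<and> (\<forall>k. Y (V k) = V (Qb (Y k))) \<and> opnorm_on UNIV Y = opnorm_on H X"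
    if eq: "\<forall>h\<in>H. X (T h) = T (Q (X h))"
  proof -
    have "contraction_on UNIV (\<lambda>k. V (Qb k))"
      using complex_linear_compose[OF linV linQ] norm_Q norm_V by (metis contraction_on_UNIV_iff)
    moreover have "(\<lambda>k. V (Qb k)) ` orthocompl H \<subseteq> orthocompl H" using V_orth Qb_orth by blast
    moreover have "X (proj H (V k)) = proj H (V (Qb (X (proj H k))))" for k
    proof -
      have "proj H (V (Qb (X (proj H k)))) = T (Qb (X (proj H k)))"
        by (simp add: projV projQ P_in P_mem XH)
      then show ?thesis using eq restr by (simp add: projV P_in XH)
    qed
    ultimately show ?thesis using intertwining_lifting[OF H isoV _ X] by metis
  qed
  have twisted_right: "\<exists>Y. lifting H X Y \<and> (\<forall>k. Y (V k) = V (Y (Qb k))) \<and> opnorm_on UNIV Y = opnorm_on H X"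
    if uni: "unitary_on UNIV Qb" and eq: "\<forall>h\<in>H. X (T h) = T (X (Q h))"
  proof -
    obtain U where U: "isometry_on UNIV U" and QU: "\<And>x. Qb (U x) = x" and UQ: "\<And>x. U (Qb x) = x"
      using unitary_on_UNIV_inverse[OF uni] by blast
    have "isometry_on UNIV (\<lambda>k. V (U k))"
      using U linV norm_V by (simp add: isometry_on_UNIV_iff complex_linear_compose)
    moreover have "contraction_on UNIV V" using linV norm_V by (simp add: contraction_on_UNIV_iff)
    moreover have "X (proj H (V (U k))) = proj H (V (X (proj H k)))" for k
    proof -
      \<comment> \<open>The vector \<open>proj H (U k)\<close> is inserted into the hypothesis;
        \<open>Qb\<close> then passes through the projection and cancels \<open>U\<close>.\<close>
      have "X (proj H (V (U k))) = T (X (Qb (proj H (U k))))"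
        using eq restr by (simp add: projV P_in)
      also have "\<dots> = T (X (proj H k))" by (simp add: QU flip: projQ)
      finally show ?thesis by (simp add: projV P_mem P_in XH)
    qed
    ultimately obtain Y where "lifting H X Y" "\<And>k. Y (V (U k)) = V (Y k)"
      "opnorm_on UNIV Y = opnorm_on H X"
      using intertwining_lifting[OF H _ _ X V_orth, of "\<lambda>k. V (U k)"] by metis
    \<comment> \<open>Substitute \<open>Qb k\<close> for \<open>k\<close> in
      \<open>Y (V (U k)) = V (Y k)\<close>.\<close>
    then show ?thesis by (metis UQ)
  qed
  show ?thesis
  proof (intro conjI impI, goal_cases)
    case 1
    then obtain Y where Y: "lifting H X Y" "\<forall>k. Y (V k) = Qb (V (Y k))"
      "opnorm_on UNIV Y = opnorm_on H X" using twisted_left by meson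
    with powers[OF Y(1)] show ?case by (elim conjE, intro exI[of _ Y] conjI)
  next
    case 2
    then obtain Y where Y: "lifting H X Y" "\<forall>k. Y (V k) = V (Qb (Y k))"
      "opnorm_on UNIV Y = opnorm_on H X" using twisted_middle by meson
    with powers[OF Y(1)] show ?case by (elim conjE, intro exI[of _ Y] conjI)
  next
    case 3
    then obtain Y where Y: "lifting H X Y" "\<forall>k. Y (V k) = V (Y (Qb k))"
      "opnorm_on UNIV Y = opnorm_on H X" using twisted_right by meson
    with powers[OF Y(1)] show ?case by (elim conjE, intro exI[of _ Y] conjI)
  qed
qed

end
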